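(* Let $N,K\ge 1$, let $X_1,\ldots,X_K\in\mathbb{C}_{\le N-1}[z]$ and let $\Gamma_{ij}(z)=X_i(z)\widetilde{X}_j(z)\in\mathbb{C}_{\le 2(N-1)}[z]$ for $i,j\in\{1,\ldots,K\}$. Let $\{\Gamma_{ij}\}_{i,j=1}^{K,K}$ be coprime (equivalently, let $X_1,\ldots,X_K$ be coprime). Then: 1. The rank-one factorization is essentially unique: for any $Y_1,\ldots,Y_K\in\mathbb{C}_{\le N-1}[z]$ with $\Gamma_{ij}=Y_i\widetilde{Y}_j$ for all $i,j$, there exists $\beta\in\mathbb{T}$ such that $Y_k=\beta X_k$ for all $k$. 2. Let $A_j(z) := \gcd(\Gamma_{j1},\ldots,\Gamma_{jK})$ and fix an index $j$ such that $A_j(z)\not\equiv 0$. Then a factorization $\Gamma_{ik}(z)=Y_i(z)\widetilde{Y}_k(z)$, $i,k\in\{1,\ldots,K\}$, is obtained by $$Y_k(z) = c_j\cdot\frac{\Gamma_{kj}(z)}{\widetilde{A}_j(z)},\qquad k\in\{1,\ldots,K\},$$ where $c_j$ is the normalization constant $c_j = \|A_j\|\big/\sqrt{\Gamma_{jj}(z)|_{z^{N-1}}}$.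
   Context: $\mathbb{T} = \{z\in\mathbb{C} : |z|=1\}$. $\mathbb{C}_{\le D}[z]$ is the $(D+1)$-dimensional space of complex univariate polynomials of degree at most $D$; a polynomial is always considered together with the space (degree bound) it belongs to. For $A(z)=\sum_{n=0}^{D} a[n]z^n \in \mathbb{C}_{\le D}[z]$, the conjugate reversal is $\widetilde{A}(z) = z^{D}\,\overline{A(\overline{z}^{-1})} = \sum_{n=0}^{D}\overline{a[D-n]}z^n \in \mathbb{C}_{\le D}[z]$ (in particular $\widetilde{A}_j$ is taken with respect to the degree bound of the space in which $A_j$ lives as a gcd), and $\|A\| = (\sum_{n=0}^{D}|a[n]|^2)^{1/2}$. $P(z)|_{z^{m}}$ denotes the coefficient of $z^m$ in $P$. Multiplication is the map $\mathbb{C}_{\le D_1}[z]\times\mathbb{C}_{\le D_2}[z]\to\mathbb{C}_{\le D_1+D_2}[z]$, and $C/B$ denotes the quotient $A$ with $C=AB$ in this sense. Divisibility: $C\in\mathbb{C}_{\le M}[z]$ has a divisor $B\in\mathbb{C}_{\le D}[z]\setminus\{0\}$ if there is $A\in\mathbb{C}_{\le M-D}[z]$ with $C=AB$. The $\gcd$ of a set of polynomials (each in its own space) is the polynomial $H\in\mathbb{C}_{\le D}[z]$ with highest possible $D$ that divides all of them in this sense; $\gcd\{A,0\}=A$, and the gcd of zero polynomials is $0\in\mathbb{C}_{\le 0}[z]$. The gcd is defined up to multiplication by a nonzero scalar ($A_j$ denotes any fixed choice). Polynomials are coprime if their gcd is $1\in\mathbb{C}_{\le 0}[z]$ (up to a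 nonzero scalar). *)

theory Defs
  imports Complex_Main "HOL-Computational_Algebra.Polynomial"
begin

(* A polynomial is always considered together with a degree bound, which may exceed its degree.
   Here the bound D is an explicit argument, or the first component of a pair (D, A). *)

definition poly_space :: "nat \<Rightarrow> complex poly set" where
  "poly_space D = {A. degree A \<le> D}"

definition conj_rev :: "nat \<Rightarrow> complex poly \<Rightarrow> complex poly" where
  "conj_rev D A = (\<Sum>n\<le>D. monom (cnj (coeff A (D - n))) n)"

definition coeff_norm :: "nat \<Rightarrow> complex poly \<Rightarrow> real" where
  "coeff_norm D A = sqrt (\<Sum>n\<le>D. (cmod (coeff A n))\<^sup>2)"

(* The cofactor must lie in the space with bound M - D, so this is stronger than B dvd C.
   D \<le> M is explicit because subtraction on nat truncates. *)
definition has_divisor :: "nat \<Rightarrow> complex poly \<Rightarrow> nat \<Rightarrow> complex poly \<Rightarrow> bool" where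
  "has_divisor M C D B \<longleftrightarrow>
     C \<in> poly_space M \<and> B \<in> poly_space D \<and> B \<noteq> 0 \<and> D \<le> M \<and>
     (\<exists>A \<in> poly_space (M - D). C = A * B)"

(* Zero polynomials are left out, whatever their bound, so that gcd {A, 0} = A. *)
definition common_divisor :: "(nat \<times> complex poly) set \<Rightarrow> nat \<Rightarrow> complex poly \<Rightarrow> bool" where
  "common_divisor S D B \<longleftrightarrow> (\<forall>(M, C) \<in> S. C \<noteq> 0 \<longrightarrow> has_divisor M C D B)"

(* A relation, since the gcd is only determined up to a nonzero scalar. The bound D is maximised,
   not the degree of H: bounds in excess of the degrees ("roots at infinity") count too. *)
definition is_gcd :: "(nat \<times> complex poly) set \<Rightarrow> nat \<Rightarrow> complex poly \<Rightarrow> bool" where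
  "is_gcd S D H \<longleftrightarrow>
     (if \<forall>(M, C) \<in> S. C = 0 then D = 0 \<and> H = 0
      else common_divisor S D H \<and> (\<forall>D' H'. common_divisor S D' H' \<longrightarrow> D' \<le> D))"

definition coprime_polys :: "(nat \<times> complex poly) set \<Rightarrow> bool" where
  "coprime_polys S \<longleftrightarrow> is_gcd S 0 1"

end

theory Submission
  imports Defs
    "HOL-Computational_Algebra.Field_as_Ring"
    "HOL-Computational_Algebra.Polynomial_Factorial"
begin

text \<open>
  A polynomial with a degree bound \<open>M\<close> is a binary form of degree \<open>M\<close>: the difference between \<open>M\<close>
  and the degree is the multiplicity of a root at infinity.  Divisibility between bounded
  polynomials therefore splits into ordinary divisibility and a comparison of the multiplicities at
  infinity (\<open>has_divisor_iff\<close>), and a family is coprime iff its ordinary gcd is \<open>1\<close> and some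
  nonzero member attains the bound (\<open>coprime_polys_iff\<close>).

  Conjugate reversal is multiplicative on bounded polynomials and an involution, so it carries
  divisors to divisors and preserves coprimality (\<open>coprime_conj_rev\<close>).  Since every divisor common to
  all \<open>F * p\<close>, with \<open>p\<close> ranging over a coprime family, already divides \<open>F\<close>, the products
  \<open>X\<^sub>i * conj_rev n (X\<^sub>j)\<close> are coprime iff the \<open>X\<^sub>i\<close> are, and the gcd of the row \<open>j\<close> is a
  scalar multiple of \<open>X\<^sub>j\<close> with bound exactly \<open>n\<close> (\<open>is_gcd_multiples\<close>).

  Uniqueness (\<open>rank_one_unique\<close>): two factorizations of the same nonzero rank-one matrix are
  proportional, \<open>X\<^sub>j * Y\<^sub>k = Y\<^sub>j * X\<^sub>k\<close>.  Both are coprime families because their products are, so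
  \<open>X\<^sub>j\<close> and \<open>Y\<^sub>j\<close>, for an index \<open>j\<close> where they are nonzero, divide each other and the factor of
  proportionality is a constant; comparing the diagonal entry at \<open>j\<close> gives it modulus one.

  Reconstruction (\<open>rank_one_reconstruction\<close>): if the gcd of row \<open>j\<close> is \<open>A = a X\<^sub>j\<close>, then
  dividing column \<open>j\<close> by the reversal of \<open>A\<close> leaves \<open>X\<^sub>k / cnj a\<close>.  The central coefficient of the
  diagonal entry is the squared norm of \<open>X\<^sub>j\<close>, so the normalization constant is \<open>\<bar>a\<bar>\<close> and \<open>Y\<^sub>k\<close> is a unimodular multiple of \<open>X\<^sub>k\<close>.
\<close>

section \<open>Conjugate reversal\<close>

lemma coeff_conj_rev:
  "coeff (conj_rev D A) n = (if n \<le> D then cnj (coeff A (D - n)) else 0)"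
  by (simp add: conj_rev_def coeff_sum)

lemma conj_rev_in_poly_space: "conj_rev D A \<in> poly_space D"
  by (auto simp: poly_space_def coeff_conj_rev intro!: degree_le)

lemma conj_rev_smult: "conj_rev D (smult a A) = smult (cnj a) (conj_rev D A)"
  by (rule poly_eqI) (simp add: coeff_conj_rev)

lemma conj_rev_conj_rev:
  assumes "A \<in> poly_space D"
  shows "conj_rev D (conj_rev D A) = A"
  using assms by (intro poly_eqI) (auto simp: coeff_conj_rev poly_space_def coeff_eq_0)

lemma conj_rev_eq_0_iff:
  assumes "A \<in> poly_space D"
  shows "conj_rev D A = 0 \<longleftrightarrow> A = 0"
  using conj_rev_conj_rev[OF assms] by (auto simp: conj_rev_def)

text \<open>The analytic form of the reversal; it makes multiplicativity visible.\<close>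

lemma poly_conj_rev:
  assumes "A \<in> poly_space D" "z \<noteq> 0"
  shows "poly (conj_rev D A) z = z ^ D * cnj (poly A (1 / cnj z))"
proof -
  have "poly (conj_rev D A) z = (\<Sum>n\<le>D. cnj (coeff A (D - n)) * z ^ n)"
    by (simp add: conj_rev_def poly_sum poly_monom)
  also have "\<dots> = (\<Sum>m\<le>D. cnj (coeff A m) * z ^ (D - m))"
    by (rule sum.reindex_bij_witness[of _ "\<lambda>m. D - m" "\<lambda>m. D - m"]) auto
  also have "\<dots> = (\<Sum>m\<le>D. z ^ D * cnj (coeff A m * (1 / cnj z) ^ m))"
    using assms(2) by (intro sum.cong) (auto simp: power_diff power_divide)
  also have "\<dots> = z ^ D * cnj (\<Sum>m\<le>D. coeff A m * (1 / cnj z) ^ m)"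
    by (simp add: sum_distrib_left)
  also have "(\<Sum>m\<le>D. coeff A m * (1 / cnj z) ^ m) = poly A (1 / cnj z)"
    unfolding poly_altdef using assms(1)
    by (intro sum.mono_neutral_right) (auto simp: poly_space_def coeff_eq_0)
  finally show ?thesis .
qed

lemma mult_in_poly_space:
  assumes "A \<in> poly_space M" "B \<in> poly_space D"
  shows "A * B \<in> poly_space (M + D)"
  using assms degree_mult_le[of A B] by (auto simp: poly_space_def)

lemma conj_rev_mult:
  assumes "A \<in> poly_space M" "B \<in> poly_space D"
  shows "conj_rev (M + D) (A * B) = conj_rev M A * conj_rev D B"
proof -
  \<comment> \<open>The extra factor vanishes at the origin, where the analytic form is not available.\<close>
  let ?z = "[:0, 1:] :: complex poly"
  have "poly (?z * conj_rev (M + D) (A * B)) = poly (?z * (conj_rev M A * conj_rev D B))"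
  proof
    fix z
    show "poly (?z * conj_rev (M + D) (A * B)) z = poly (?z * (conj_rev M A * conj_rev D B)) z"
    proof (cases "z = 0")
      case False
      then show ?thesis
        using assms mult_in_poly_space[OF assms] by (simp add: poly_conj_rev power_add)
    qed simp
  qed
  then have "?z * conj_rev (M + D) (A * B) = ?z * (conj_rev M A * conj_rev D B)"
    by (simp only: poly_eq_poly_eq_iff)
  then show ?thesis
    by (subst (asm) mult_cancel_left) simp
qed

lemma coeff_mult_conj_rev_self:
  "coeff (A * conj_rev D A) D = of_real ((coeff_norm D A)\<^sup>2)"
proof -
  have "coeff (A * conj_rev D A) D = (\<Sum>i\<le>D. of_real ((cmod (coeff A i))\<^sup>2))"
    unfolding coeff_mult
    by (intro sum.cong) (auto simp: coeff_conj_rev complex_norm_square simp del: of_real_power)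
  also have "\<dots> = of_real ((coeff_norm D A)\<^sup>2)"
    by (simp add: coeff_norm_def sum_nonneg)
  finally show ?thesis .
qed

lemma coeff_norm_smult: "coeff_norm D (smult a A) = cmod a * coeff_norm D A"
  by (simp add: coeff_norm_def norm_mult power_mult_distrib real_sqrt_mult flip: sum_distrib_left)

lemma coeff_norm_pos:
  assumes "A \<in> poly_space D" "A \<noteq> 0"
  shows "coeff_norm D A > 0"
proof -
  have "(\<Sum>n\<le>D. (cmod (coeff A n))\<^sup>2) > 0"
    using assms by (intro sum_pos2[where i = "degree A"]) (auto simp: poly_space_def)
  then show ?thesis by (simp add: coeff_norm_def)
qed

section \<open>Divisibility and coprimality with degree bounds\<close>

text \<open>The last conjunct compares the multiplicities of the root at infinity, \<open>D - degree B\<close> and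
  \<open>M - degree C\<close>, in a form free of truncated subtraction.\<close>

lemma has_divisor_iff:
  assumes "C \<noteq> 0"
  shows "has_divisor M C D B \<longleftrightarrow>
    degree C \<le> M \<and> B dvd C \<and> degree B \<le> D \<and> D + degree C \<le> M + degree B"
proof
  assume "has_divisor M C D B"
  then obtain A where "degree C \<le> M" "degree B \<le> D" "D \<le> M" "degree A \<le> M - D" "C = A * B"
    by (auto simp: has_divisor_def poly_space_def)
  moreover from this assms have "degree C = degree A + degree B"
    by (auto simp: degree_mult_eq)
  ultimately show "degree C \<le> M \<and> B dvd C \<and> degree B \<le> D \<and> D + degree C \<le> M + degree B"
    by auto
next
  assume *: "degree C \<le> M \<and> B dvd C \<and> degree B \<le> D \<and> D + degree C \<le> M + degree B"
  then obtain A where A: "C = A * B" by (metis dvdE mult.commute)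
  with assms have "A \<noteq> 0" "B \<noteq> 0" "degree C = degree A + degree B"
    by (auto simp: degree_mult_eq)
  with * A show "has_divisor M C D B"
    by (auto simp: has_divisor_def poly_space_def)
qed

lemma has_divisor_conj_rev:
  assumes "has_divisor M C D B"
  shows "has_divisor M (conj_rev M C) D (conj_rev D B)"
proof -
  from assms obtain A where A: "A \<in> poly_space (M - D)" "C = A * B" "B \<in> poly_space D" "B \<noteq> 0" "D \<le> M"
    by (auto simp: has_divisor_def)
  then have "conj_rev M C = conj_rev (M - D) A * conj_rev D B"
    using conj_rev_mult[of A "M - D" B D] by simp
  with A show ?thesis
    unfolding has_divisor_def using conj_rev_in_poly_space conj_rev_eq_0_iff by blast
qed

lemma Gcd_eq_1_if_unit:
  fixes P :: "complex poly set"
  assumes "is_unit (Gcd P)"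
  shows "Gcd P = 1"
  using is_unit_normalize[OF assms] normalize_Gcd[of P] by (rule trans[OF sym, rotated])

text \<open>The constant \<open>1\<close> with bound \<open>0\<close> divides everything, so only maximality of its bound matters.
  The zero family has gcd \<open>0\<close> and must be excluded.\<close>

lemma coprime_polys_iff_bound:
  assumes "P \<subseteq> poly_space M"
  shows "coprime_polys (Pair M ` P) \<longleftrightarrow>
    \<not> P \<subseteq> {0} \<and> (\<forall>D B. common_divisor (Pair M ` P) D B \<longrightarrow> D = 0)"
proof -
  have "common_divisor (Pair M ` P) 0 1"
    using assms by (auto simp: common_divisor_def has_divisor_def poly_space_def)
  then show ?thesis
    by (auto simp: coprime_polys_def is_gcd_def)
qed

lemma coprime_polys_iff:
  assumes "P \<subseteq> poly_space M"
  shows "coprime_polys (Pair M ` P) \<longleftrightarrow> Gcd P = 1 \<and> (\<exists>p\<in>P. p \<noteq> 0 \<and> degree p = M)"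
proof
  assume "coprime_polys (Pair M ` P)"
  then have nz: "\<not> P \<subseteq> {0}" and bound: "\<And>D B. common_divisor (Pair M ` P) D B \<Longrightarrow> D = 0"
    using assms by (auto simp: coprime_polys_iff_bound)
  from nz have G: "Gcd P \<noteq> 0" by (simp add: Gcd_0_iff)
  have "common_divisor (Pair M ` P) (degree (Gcd P)) (Gcd P)"
    using assms by (auto simp: common_divisor_def has_divisor_iff poly_space_def intro: Gcd_dvd)
  then have "degree (Gcd P) = 0" by (rule bound)
  with G have "is_unit (Gcd P)" by (simp add: is_unit_iff_degree)
  then have "Gcd P = 1" by (rule Gcd_eq_1_if_unit)
  moreover have "\<exists>p\<in>P. p \<noteq> 0 \<and> degree p = M"
  proof (rule ccontr)
    \<comment> \<open>Otherwise infinity is a common root, that is, the constant \<open>1\<close> with bound \<open>1\<close> is a divisor.\<close>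
    assume "\<not> ?thesis"
    then have "\<And>p. p \<in> P \<Longrightarrow> p \<noteq> 0 \<Longrightarrow> degree p < M"
      using assms by (force simp: poly_space_def)
    then have "common_divisor (Pair M ` P) 1 1"
      by (force simp: common_divisor_def has_divisor_iff)
    then show False using bound by fastforce
  qed
  ultimately show "Gcd P = 1 \<and> (\<exists>p\<in>P. p \<noteq> 0 \<and> degree p = M)" by blast
next
  assume R: "Gcd P = 1 \<and> (\<exists>p\<in>P. p \<noteq> 0 \<and> degree p = M)"
  then obtain p where p: "p \<in> P" "p \<noteq> 0" "degree p = M" by blast
  have "D = 0" if cd: "common_divisor (Pair M ` P) D B" for D B
  proof -
    have "B dvd q" if "q \<in> P" for q
      using cd that by (cases "q = 0") (auto simp: common_divisor_def has_divisor_iff)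
    then have "B dvd Gcd P" by (rule Gcd_greatest)
    then have "B dvd 1" using R by simp
    moreover from this have "B \<noteq> 0" by auto
    ultimately have "degree B = 0" using is_unit_iff_degree by blast
    moreover have "D + M \<le> M + degree B"
      using cd p by (auto simp: common_divisor_def has_divisor_iff)
    ultimately show "D = 0" by simp
  qed
  with p assms show "coprime_polys (Pair M ` P)"
    by (auto simp: coprime_polys_iff_bound)
qed

text \<open>A common divisor of the reversals is the reversal of a common divisor with the same bound.
  Reversal exchanges roots at the origin and at infinity, so the statement would fail for
  coprimality without bounds.\<close>

lemma coprime_conj_rev:
  assumes "P \<subseteq> poly_space M" "coprime_polys (Pair M ` P)"
  shows "coprime_polys (Pair M ` conj_rev M ` P)"
proof -
  have "conj_rev M ` P \<subseteq> poly_space M"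
    by (auto simp: conj_rev_in_poly_space)
  moreover have "\<not> conj_rev M ` P \<subseteq> {0}"
  proof -
    obtain p where "p \<in> P" "p \<noteq> 0" using assms by (auto simp: coprime_polys_iff_bound)
    moreover from this have "conj_rev M p \<noteq> 0" using assms(1) conj_rev_eq_0_iff by blast
    ultimately show ?thesis by blast
  qed
  moreover have "D = 0" if cd: "common_divisor (Pair M ` conj_rev M ` P) D B" for D B
  proof -
    have "has_divisor M p D (conj_rev D B)" if "p \<in> P" "p \<noteq> 0" for p
    proof -
      have p: "p \<in> poly_space M" using that assms by auto
      then have "has_divisor M (conj_rev M p) D B"
        using cd that by (auto simp: common_divisor_def conj_rev_eq_0_iff)
      from has_divisor_conj_rev[OF this] show ?thesis
        by (simp add: conj_rev_conj_rev[OF p])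
    qed
    then have "common_divisor (Pair M ` P) D (conj_rev D B)"
      by (auto simp: common_divisor_def)
    then show ?thesis using assms by (auto simp: coprime_polys_iff_bound)
  qed
  ultimately show ?thesis by (auto simp: coprime_polys_iff_bound)
qed

section \<open>Products with a coprime family\<close>

lemma dvd_cancel_Gcd_1:
  fixes B F :: "complex poly"
  assumes "\<And>p. p \<in> P \<Longrightarrow> B dvd F * p" "Gcd P = 1"
  shows "B dvd F"
proof -
  have "B dvd Gcd ((*) F ` P)" using assms(1) by (auto intro: Gcd_greatest)
  then show ?thesis by (simp add: Gcd_mult assms(2))
qed

lemma dvd_imp_smult_if_degree_le:
  fixes A F :: "complex poly"
  assumes "A dvd F" "F \<noteq> 0" "degree F \<le> degree A"
  obtains a where "a \<noteq> 0" "A = smult a F"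
proof -
  from assms(1) obtain B where B: "F = A * B" by (rule dvdE)
  with assms have "B \<noteq> 0" "degree B = 0" by (auto simp: degree_mult_eq)
  then obtain b where b: "B = [:b:]" "b \<noteq> 0" by (auto elim: degree_eq_zeroE)
  have "smult (1 / b) F = A" unfolding B b(1) using b(2) by simp
  with b(2) show ?thesis by (intro that[of "1 / b"]) simp_all
qed

text \<open>The factor \<open>F\<close> with bound \<open>m\<close> is a common divisor, and coprimality of \<open>P\<close> both at finite points
  and at infinity leaves no room for a larger one.\<close>

lemma is_gcd_multiples:
  assumes P: "P \<subseteq> poly_space n" "coprime_polys (Pair n ` P)"
    and F: "F \<in> poly_space m"
    and gcd: "is_gcd (Pair (m + n) ` (*) F ` P) D A" and "A \<noteq> 0"
  obtains a where "D = m" "a \<noteq> 0" "A = smult a F"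
proof -
  from P obtain p where p: "Gcd P = 1" "p \<in> P" "p \<noteq> 0" "degree p = n"
    by (auto simp: coprime_polys_iff)
  from gcd \<open>A \<noteq> 0\<close> have nz: "F \<noteq> 0"
    and cd: "common_divisor (Pair (m + n) ` (*) F ` P) D A"
    and max: "\<And>D' B. common_divisor (Pair (m + n) ` (*) F ` P) D' B \<Longrightarrow> D' \<le> D"
    unfolding is_gcd_def by (force split: if_splits)+
  have "has_divisor (m + n) (F * q) m F" if "q \<in> P" "q \<noteq> 0" for q
  proof -
    have "degree q \<le> n" using that P(1) by (auto simp: poly_space_def)
    then show ?thesis
      using F nz that by (simp add: has_divisor_iff degree_mult_eq poly_space_def)
  qed
  then have "common_divisor (Pair (m + n) ` (*) F ` P) m F"
    by (auto simp: common_divisor_def)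
  then have "m \<le> D" by (rule max)
  have "A dvd F * q" if "q \<in> P" for q
    using cd that nz by (cases "q = 0") (auto simp: common_divisor_def has_divisor_iff)
  then have "A dvd F" using p(1) by (rule dvd_cancel_Gcd_1)
  then have "degree A \<le> degree F" using nz by (rule dvd_imp_degree_le)
  have "D + degree (F * p) \<le> m + n + degree A"
    using cd p nz by (auto simp: common_divisor_def has_divisor_iff)
  then have "D + degree F \<le> m + degree A"
    using p nz by (simp add: degree_mult_eq)
  with \<open>m \<le> D\<close> \<open>degree A \<le> degree F\<close> have "D = m" "degree F \<le> degree A" by auto
  from \<open>A dvd F\<close> nz \<open>degree F \<le> degree A\<close> obtain a where "a \<noteq> 0" "A = smult a F"
    by (rule dvd_imp_smult_if_degree_le)
  with that \<open>D = m\<close> show ?thesis by blast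
qed

section \<open>Rank-one factorizations\<close>

text \<open>Common divisors of the \<open>X\<^sub>i\<close> divide the products.  If conversely the \<open>X\<^sub>i\<close> are coprime, so
  are their reversals, and a common divisor of all products divides first every \<open>X\<^sub>i\<close> and then
  \<open>1\<close>; at infinity, both families have a member that attains the bound.\<close>

lemma coprime_products_iff:
  assumes X: "\<And>i. i \<in> I \<Longrightarrow> X i \<in> poly_space n"
  shows "coprime_polys (Pair (n + n) ` {X i * conj_rev n (X j) | i j. i \<in> I \<and> j \<in> I}) \<longleftrightarrow>
    coprime_polys (Pair n ` X ` I)" (is "coprime_polys (_ ` ?P) \<longleftrightarrow> _")
proof -
  have XI: "X ` I \<subseteq> poly_space n" using X by auto
  have XR: "conj_rev n ` X ` I \<subseteq> poly_space n" by (auto simp: conj_rev_in_poly_space)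
  have PI: "?P \<subseteq> poly_space (n + n)"
    using X by (auto intro!: mult_in_poly_space conj_rev_in_poly_space)
  show ?thesis
  proof
    assume L: "coprime_polys (Pair (n + n) ` ?P)"
    then obtain i j where ij: "Gcd ?P = 1" "i \<in> I" "j \<in> I" "X i * conj_rev n (X j) \<noteq> 0"
      "degree (X i * conj_rev n (X j)) = n + n"
      unfolding coprime_polys_iff[OF PI] by blast
    have "Gcd (X ` I) dvd Gcd ?P"
      by (rule Gcd_greatest) (auto intro!: dvd_mult2[OF Gcd_dvd])
    with ij have "is_unit (Gcd (X ` I))" by simp
    then have "Gcd (X ` I) = 1" by (rule Gcd_eq_1_if_unit)
    moreover have "X i \<noteq> 0" "degree (X i) = n"
      using ij X[of i] conj_rev_in_poly_space[of n "X j"]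
      by (auto simp: degree_mult_eq poly_space_def)
    ultimately show "coprime_polys (Pair n ` X ` I)"
      unfolding coprime_polys_iff[OF XI] using ij by blast
  next
    assume R: "coprime_polys (Pair n ` X ` I)"
    then obtain i where i: "Gcd (X ` I) = 1" "i \<in> I" "X i \<noteq> 0" "degree (X i) = n"
      unfolding coprime_polys_iff[OF XI] by blast
    from coprime_conj_rev[OF XI R] obtain j where j: "Gcd (conj_rev n ` X ` I) = 1" "j \<in> I"
      "conj_rev n (X j) \<noteq> 0" "degree (conj_rev n (X j)) = n"
      unfolding coprime_polys_iff[OF XR] by blast
    have "Gcd ?P dvd 1 * X k" if "k \<in> I" for k
      by (rule dvd_cancel_Gcd_1[OF _ j(1)]) (use that in \<open>auto intro!: Gcd_dvd\<close>)
    then have "\<And>p. p \<in> X ` I \<Longrightarrow> Gcd ?P dvd 1 * p" by blast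
    then have "Gcd ?P dvd 1" using i(1) by (rule dvd_cancel_Gcd_1)
    then have "Gcd ?P = 1" by (rule Gcd_eq_1_if_unit)
    moreover have "X i * conj_rev n (X j) \<noteq> 0" "degree (X i * conj_rev n (X j)) = n + n"
      using i j by (auto simp: degree_mult_eq)
    ultimately show "coprime_polys (Pair (n + n) ` ?P)"
      unfolding coprime_polys_iff[OF PI] using i j by blast
  qed
qed

lemma rank_one_unique:
  assumes X: "\<And>i. i \<in> I \<Longrightarrow> X i \<in> poly_space n" and Y: "\<And>i. i \<in> I \<Longrightarrow> Y i \<in> poly_space n"
    and eq: "\<And>i j. i \<in> I \<Longrightarrow> j \<in> I \<Longrightarrow> X i * conj_rev n (X j) = Y i * conj_rev n (Y j)"
    and GX: "Gcd (X ` I) = 1" and GY: "Gcd (Y ` I) = 1"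
  obtains \<beta> where "cmod \<beta> = 1" "\<And>k. k \<in> I \<Longrightarrow> Y k = smult \<beta> (X k)"
proof -
  from GX have "\<not> X ` I \<subseteq> {0}" by (auto simp flip: Gcd_0_iff)
  then obtain j where j: "j \<in> I" "X j \<noteq> 0" by auto
  then have nz: "conj_rev n (X j) \<noteq> 0" using X by (simp add: conj_rev_eq_0_iff)
  \<comment> \<open>The two columns \<open>X\<close> and \<open>Y\<close> are both proportional to column \<open>j\<close> of the matrix.\<close>
  have proportional: "X j * Y k = Y j * X k" if "k \<in> I" for k
  proof -
    have "(X j * Y k) * conj_rev n (X j) = Y k * (X j * conj_rev n (X j))"
      by (simp add: algebra_simps)
    also have "\<dots> = Y j * (Y k * conj_rev n (Y j))"
      using eq[OF j(1) j(1)] by (simp add: algebra_simps)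
    also have "\<dots> = (Y j * X k) * conj_rev n (X j)"
      using eq[OF that j(1)] by (simp add: algebra_simps)
    finally show ?thesis using nz by simp
  qed
  have "X j dvd Y j"
    by (rule dvd_cancel_Gcd_1[OF _ GX]) (metis dvd_triv_left imageE proportional)
  moreover have "Y j dvd X j"
    by (rule dvd_cancel_Gcd_1[OF _ GY]) (metis dvd_triv_left imageE proportional)
  moreover from eq[OF j(1) j(1)] j nz have "Y j \<noteq> 0" by auto
  ultimately have "Y j dvd X j" "degree (X j) \<le> degree (Y j)"
    by (simp_all add: dvd_imp_degree_le)
  then obtain \<beta> where \<beta>: "Y j = smult \<beta> (X j)"
    by (rule dvd_imp_smult_if_degree_le[OF _ j(2)])
  have Yk: "Y k = smult \<beta> (X k)" if "k \<in> I" for k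
  proof -
    have "X j * Y k = X j * smult \<beta> (X k)" using proportional[OF that] \<beta> by simp
    then show ?thesis using j(2) mult_cancel_left by blast
  qed
  have "X j * conj_rev n (X j) = smult (\<beta> * cnj \<beta>) (X j * conj_rev n (X j))"
    using eq[OF j(1) j(1)] by (simp add: \<beta> conj_rev_smult mult.commute)
  then have "smult (1 - \<beta> * cnj \<beta>) (X j * conj_rev n (X j)) = 0"
    by (simp add: smult_diff_left)
  with j nz have "\<beta> * cnj \<beta> = 1" by simp
  then have "(cmod \<beta>)\<^sup>2 = 1"
    by (simp only: complex_norm_square[symmetric] of_real_eq_1_iff)
  then have "cmod \<beta> = 1" by (simp add: power2_eq_1_iff) (use norm_ge_zero[of \<beta>] in linarith)
  then show ?thesis using Yk by (rule that)
qed

text \<open>The scalar \<open>a\<close> is the one that the choice of the gcd leaves free.  It enters the quotient as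
  \<open>1 / cnj a\<close>; the normalization constant equals \<open>\<bar>a\<bar>\<close> and so removes its modulus, while a phase
  common to all \<open>Y\<^sub>k\<close> cancels in \<open>Y\<^sub>i * conj_rev n (Y\<^sub>k)\<close>.\<close>

lemma rank_one_reconstruction:
  assumes F: "F \<in> poly_space n" "F \<noteq> 0" and a: "a \<noteq> 0"
    and c: "c = of_real (coeff_norm n (smult a F)) / csqrt (coeff (F * conj_rev n F) n)"
  shows "smult c (P * conj_rev n F div conj_rev n (smult a F)) =
    smult (of_real (cmod a) / cnj a) P"
proof -
  have pos: "coeff_norm n F > 0" by (rule coeff_norm_pos[OF F])
  have "csqrt (coeff (F * conj_rev n F) n) = of_real (coeff_norm n F)"
    using pos by (simp add: coeff_mult_conj_rev_self csqrt_of_real_nonneg del: of_real_power)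
  then have "c = of_real (cmod a)" using pos by (simp add: c coeff_norm_smult)
  moreover have "P * conj_rev n F div conj_rev n (smult a F) = smult (1 / cnj a) P"
  proof -
    have "P * conj_rev n F = smult (1 / cnj a) P * conj_rev n (smult a F)"
      using a by (simp add: conj_rev_smult)
    moreover have "conj_rev n (smult a F) \<noteq> 0"
      using a F by (simp add: conj_rev_smult conj_rev_eq_0_iff)
    ultimately show ?thesis by (simp only: nonzero_mult_div_cancel_right not_False_eq_True)
  qed
  ultimately show ?thesis by simp
qed

theorem proposition19:
  fixes N K :: nat
    and X :: "nat \<Rightarrow> complex poly"
    and \<Gamma> :: "nat \<Rightarrow> nat \<Rightarrow> complex poly"
  assumes "N \<ge> 1" and "K \<ge> 1"
    and "\<forall>i\<in>{1..K}. X i \<in> poly_space (N - 1)"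
    and "\<forall>i\<in>{1..K}. \<forall>j\<in>{1..K}. \<Gamma> i j = X i * conj_rev (N - 1) (X j)"
  shows
    "(coprime_polys {(2 * (N - 1), \<Gamma> i j) | i j. i \<in> {1..K} \<and> j \<in> {1..K}} \<longleftrightarrow>
        coprime_polys {(N - 1, X i) | i. i \<in> {1..K}}) \<and>
     (coprime_polys {(2 * (N - 1), \<Gamma> i j) | i j. i \<in> {1..K} \<and> j \<in> {1..K}} \<longrightarrow>
        (\<forall>Y :: nat \<Rightarrow> complex poly.
           (\<forall>k\<in>{1..K}. Y k \<in> poly_space (N - 1)) \<and>
           (\<forall>i\<in>{1..K}. \<forall>j\<in>{1..K}. \<Gamma> i j = Y i * conj_rev (N - 1) (Y j)) \<longrightarrow>
           (\<exists>\<beta>. cmod \<beta> = 1 \<and> (\<forall>k\<in>{1..K}. Y k = smult \<beta> (X k)))) \<and>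
        (\<forall>j\<in>{1..K}. \<forall>(D :: nat) (A :: complex poly) (c :: complex) (Y :: nat \<Rightarrow> complex poly).
           is_gcd {(2 * (N - 1), \<Gamma> j k) | k. k \<in> {1..K}} D A \<and> A \<noteq> 0 \<and>
           c = of_real (coeff_norm D A) / csqrt (coeff (\<Gamma> j j) (N - 1)) \<and>
           (\<forall>k\<in>{1..K}. Y k = smult c (\<Gamma> k j div conj_rev D A)) \<longrightarrow>
           (\<forall>k\<in>{1..K}. has_divisor (2 * (N - 1)) (\<Gamma> k j) D (conj_rev D A)) \<and>
           (\<forall>k\<in>{1..K}. Y k \<in> poly_space (N - 1)) \<and>
           (\<forall>i\<in>{1..K}. \<forall>k\<in>{1..K}. \<Gamma> i k = Y i * conj_rev (N - 1) (Y k))))"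
proof -
  define n where "n = N - 1"
  define I where "I = {1..K}"
  have X: "X i \<in> poly_space n" if "i \<in> I" for i
    using assms(3) that by (auto simp: n_def I_def)
  then have XI: "X ` I \<subseteq> poly_space n" by auto
  have \<Gamma>: "\<Gamma> i j = X i * conj_rev n (X j)" if "i \<in> I" "j \<in> I" for i j
    using assms(4) that by (auto simp: n_def I_def)
  have SX: "{(n, X i) | i. i \<in> I} = Pair n ` X ` I" by auto
  have equiv: "coprime_polys {(2 * n, \<Gamma> i j) | i j. i \<in> I \<and> j \<in> I} \<longleftrightarrow>
      coprime_polys (Pair n ` Z ` I)"
    if Z: "\<And>i. i \<in> I \<Longrightarrow> Z i \<in> poly_space n"
      "\<And>i j. i \<in> I \<Longrightarrow> j \<in> I \<Longrightarrow> \<Gamma> i j = Z i * conj_rev n (Z j)" for Z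
  proof -
    have "{(2 * n, \<Gamma> i j) | i j. i \<in> I \<and> j \<in> I} =
        Pair (n + n) ` {Z i * conj_rev n (Z j) | i j. i \<in> I \<and> j \<in> I}"
      using Z(2) by (force simp: mult_2)
    then show ?thesis using coprime_products_iff[of I Z n] Z(1) by simp
  qed
  have unique: "\<exists>\<beta>. cmod \<beta> = 1 \<and> (\<forall>k\<in>I. Y k = smult \<beta> (X k))"
    if co: "coprime_polys {(2 * n, \<Gamma> i j) | i j. i \<in> I \<and> j \<in> I}"
      and Y: "\<forall>k\<in>I. Y k \<in> poly_space n" "\<forall>i\<in>I. \<forall>j\<in>I. \<Gamma> i j = Y i * conj_rev n (Y j)" for Y
  proof -
    have YI: "Y ` I \<subseteq> poly_space n" using Y by auto
    have "Gcd (X ` I) = 1" using co equiv[of X] X \<Gamma> XI by (simp add: coprime_polys_iff)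
    moreover have "Gcd (Y ` I) = 1" using co equiv[of Y] Y YI by (simp add: coprime_polys_iff)
    ultimately obtain \<beta> where "cmod \<beta> = 1" "\<And>k. k \<in> I \<Longrightarrow> Y k = smult \<beta> (X k)"
      using rank_one_unique[of I X n Y] X Y \<Gamma> by auto
    then show ?thesis by blast
  qed
  have reconstruct: "(\<forall>k\<in>I. has_divisor (2 * n) (\<Gamma> k j) D (conj_rev D A)) \<and>
      (\<forall>k\<in>I. Y k \<in> poly_space n) \<and> (\<forall>i\<in>I. \<forall>k\<in>I. \<Gamma> i k = Y i * conj_rev n (Y k))"
    if co: "coprime_polys {(2 * n, \<Gamma> i j) | i j. i \<in> I \<and> j \<in> I}" and j: "j \<in> I"
      and gcd: "is_gcd {(2 * n, \<Gamma> j k) | k. k \<in> I} D A" and "A \<noteq> 0"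
      and c: "c = of_real (coeff_norm D A) / csqrt (coeff (\<Gamma> j j) n)"
      and Y: "\<forall>k\<in>I. Y k = smult c (\<Gamma> k j div conj_rev D A)" for j D A c Y
  proof -
    have coX: "coprime_polys (Pair n ` X ` I)" using co equiv X \<Gamma> by blast
    have "{(2 * n, \<Gamma> j k) | k. k \<in> I} = Pair (n + n) ` (*) (X j) ` conj_rev n ` X ` I"
      using \<Gamma> j by (force simp: mult_2)
    then have "is_gcd (Pair (n + n) ` (*) (X j) ` conj_rev n ` X ` I) D A"
      using gcd by simp
    then obtain a where a: "D = n" "a \<noteq> 0" "A = smult a (X j)"
      by (rule is_gcd_multiples[rotated 3])
         (use \<open>A \<noteq> 0\<close> j X coprime_conj_rev[OF XI coX] in \<open>auto simp: conj_rev_in_poly_space\<close>)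
    with \<open>A \<noteq> 0\<close> have nz: "X j \<noteq> 0" by auto
    define b where "b = of_real (cmod a) / cnj a"
    have Yk: "Y k = smult b (X k)" if "k \<in> I" for k
      unfolding b_def using rank_one_reconstruction[of "X j" n a c "X k"] Y c a j that X nz \<Gamma> by simp
    have bb: "b * cnj b = 1"
      using a by (simp add: b_def complex_norm_square[symmetric] power2_eq_square field_simps)
    have "has_divisor (2 * n) (\<Gamma> k j) D (conj_rev D A)" if k: "k \<in> I" for k
    proof -
      have "\<Gamma> k j = smult (1 / cnj a) (X k) * conj_rev n A"
        using a k j by (simp add: \<Gamma> conj_rev_smult)
      moreover have "conj_rev n A \<noteq> 0"
        using a nz j X by (simp add: conj_rev_smult conj_rev_eq_0_iff)
      moreover have "\<Gamma> k j \<in> poly_space (2 * n)"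
        using mult_in_poly_space[OF X[OF k] conj_rev_in_poly_space[of n "X j"]] k j
        by (simp add: \<Gamma> mult_2)
      moreover have "smult (1 / cnj a) (X k) \<in> poly_space (2 * n - n)"
        using X[OF k] by (simp add: poly_space_def)
      ultimately show ?thesis
        unfolding has_divisor_def a(1) using conj_rev_in_poly_space by (intro conjI bexI) auto
    qed
    moreover have "Y k \<in> poly_space n" if "k \<in> I" for k
      using X[OF that] Yk[OF that] degree_smult_le[of b "X k"] by (simp add: poly_space_def)
    moreover have "\<Gamma> i k = Y i * conj_rev n (Y k)" if "i \<in> I" "k \<in> I" for i k
      using that bb by (simp add: \<Gamma> Yk conj_rev_smult mult.commute)
    ultimately show ?thesis by blast
  qed
  show ?thesis
    unfolding n_def[symmetric] I_def[symmetric]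
    using equiv[OF X \<Gamma>] unique reconstruct unfolding SX by blast
qed

end
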